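(* Let $T$ be a tree of order $n\ge 8$ and let $e$ be a non-pendent edge of $T$. Let $T_1$ and $T_2$ be the two components of $T-e$, so that $T-e=T_1\cup T_2$. Let $\sigma$ be the number of Laplacian eigenvalues of $T-e$ that are greater than or equal to the average degree $\overline{d}(T-e)=2-\frac{4}{n}$ of $T-e$, and for $i=1,2$ let $k_i$ be the number of Laplacian eigenvalues of $T_i$ that are greater than or equal to $\overline{d}(T-e)$ (so $k_1+k_2=\sigma$). Then $$LE(T)\ge 2S_{k_1}(T_1)+2S_{k_2}(T_2)-4\sigma+\frac{4\sigma}{n}.$$
   Context: For a simple graph $G$ with $n$ vertices and $m$ edges, let $L(G)=D(G)-A(G)$ be its Laplacian matrix ($D(G)$ the diagonal matrix of vertex degrees, $A(G)$ the adjacency matrix), with eigenvalues (the Laplacian eigenvalues of $G$) $\mu_1(G)\ge\mu_2(G)\ge\dots\ge\mu_n(G)=0$ counted with multiplicity. The average degree is $\overline{d}(G)=\frac{2m}{n}$. The Laplacian energy is $LE(G)=\sum_{i=1}^{n}\left|\mu_i(G)-\overline{d}(G)\right|$. For a nonnegative integer $k$ not exceeding the order of $G$, $S_k(G)=\sum_{i=1}^{k}\mu_i(G)$ is the sum of the $k$ largest Laplacian eigenvalues of $G$. An edge is non-pendent if neither of its endpoints has degree $1$; $T-e$ is the graph obtained from $T$ by deleting the edge $e$ and keeping all vertices. Eigenvalues are always counted with multiplicity. *)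

theory Defs
  imports
    Complex_Main
    "HOL-Computational_Algebra.Polynomial"
    "Graph_Theory.Digraph_Component"
    "Jordan_Normal_Form.Char_Poly"
begin

text \<open>
  Finite simple graphs are the \<^locale>\<open>graph\<close>s of the digraph library, i.e. finite symmetric
  digraphs without loops and multiple arcs. An undirected edge is a two-element vertex set, carried
  by a pair of opposite arcs. The degree of a vertex is its \<^const>\<open>out_degree\<close>, and the
  connected components are the members of \<^const>\<open>pre_digraph.sccs\<close>, since in a symmetric digraph
  connectedness and strong connectedness agree.
\<close>

definition edges :: "('a, 'b) pre_digraph \<Rightarrow> 'a set set" where
  "edges G = (\<lambda>a. {tail G a, head G a}) ` arcs G"

definition del_edge :: "('a, 'b) pre_digraph \<Rightarrow> 'a set \<Rightarrow> ('a, 'b) pre_digraph" where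
  "del_edge G e = G \<lparr> arcs := {a \<in> arcs G. {tail G a, head G a} \<noteq> e} \<rparr>"

definition non_pendent :: "('a, 'b) pre_digraph \<Rightarrow> 'a set \<Rightarrow> bool" where
  "non_pendent G e \<longleftrightarrow> (\<forall>v \<in> e. out_degree G v \<noteq> 1)"

text \<open>
  The constants \<open>forest\<close> and \<open>tree\<close> of the digraph library are unsuitable here: they forbid directed
  cycles, and every pair of opposite arcs is one, of length 2. The cycles of an undirected simple
  graph are the directed cycles of length at least 3.
\<close>

definition undirected_tree :: "('a, 'b) pre_digraph \<Rightarrow> bool" where
  "undirected_tree G \<longleftrightarrow>
     graph G \<and> Digraph_Component.connected G \<and> \<not> (\<exists>p. pre_digraph.cycle G p \<and> 3 \<le> length p)"

definition avg_degree :: "('a, 'b) pre_digraph \<Rightarrow> real" where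
  "avg_degree G = 2 * real (card (edges G)) / real (card (verts G))"

text \<open>
  Matrices are indexed by \<open>{0..<n}\<close>, so the vertices are listed in some fixed order. Another order
  conjugates the matrices by a permutation matrix and does not change the characteristic polynomial.
\<close>

definition vert_list :: "('a, 'b) pre_digraph \<Rightarrow> 'a list" where
  "vert_list G = (SOME vs. distinct vs \<and> set vs = verts G)"

definition degree_matrix :: "('a, 'b) pre_digraph \<Rightarrow> real mat" where
  "degree_matrix G = mat (card (verts G)) (card (verts G))
     (\<lambda>(i, j). if i = j then real (out_degree G (vert_list G ! i)) else 0)"

definition adjacency_matrix :: "('a, 'b) pre_digraph \<Rightarrow> real mat" where
  "adjacency_matrix G = mat (card (verts G)) (card (verts G))
     (\<lambda>(i, j). if vert_list G ! i \<rightarrow>\<^bsub>G\<^esub> vert_list G ! j then 1 else 0)"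

definition laplacian_matrix :: "('a, 'b) pre_digraph \<Rightarrow> real mat" where
  "laplacian_matrix G = degree_matrix G - adjacency_matrix G"

text \<open>
  The Laplacian matrix is real symmetric, so its characteristic polynomial splits over the reals and
  the multiset of its real roots contains all \<open>n\<close> eigenvalues with their multiplicities.
\<close>

definition laplacian_spectrum :: "('a, 'b) pre_digraph \<Rightarrow> real multiset" where
  "laplacian_spectrum G = proots (char_poly (laplacian_matrix G))"

definition laplacian_energy :: "('a, 'b) pre_digraph \<Rightarrow> real" where
  "laplacian_energy G = (\<Sum>\<mu> \<in># laplacian_spectrum G. \<bar>\<mu> - avg_degree G\<bar>)"

definition laplacian_eigenvalues :: "('a, 'b) pre_digraph \<Rightarrow> real list" where
  "laplacian_eigenvalues G = rev (sorted_list_of_multiset (laplacian_spectrum G))"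

definition sum_largest :: "nat \<Rightarrow> ('a, 'b) pre_digraph \<Rightarrow> real" where
  "sum_largest k G = sum_list (take k (laplacian_eigenvalues G))"

definition num_eigenvalues_ge :: "real \<Rightarrow> ('a, 'b) pre_digraph \<Rightarrow> nat" where
  "num_eigenvalues_ge c G = size {# \<mu> \<in># laplacian_spectrum G. c \<le> \<mu> #}"

end

theory Submission
  imports Defs "Jordan_Normal_Form.Schur_Decomposition"
begin

text \<open>
  The Laplacian eigenvalues of a graph sum to twice its number of edges, so
  \<open>LE(T) = 2 \<Sum> max (\<mu> - d) 0\<close> with \<open>d = 2 - 2 / n\<close> the average degree of \<open>T\<close>. Deleting an edge
  decreases the Laplacian quadratic form, so evaluating the form of \<open>T\<close> on orthonormal eigenvectors of
  \<open>T - e\<close> bounds this from below by \<open>2 \<Sum> (\<lambda> - d)\<close>, for any selection of eigenvalues \<open>\<lambda>\<close> of \<open>T - e\<close>.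
  Select the \<open>\<sigma>\<close> eigenvalues that are at least the average degree of \<open>T - e\<close>. As the Laplacian of
  \<open>T - e\<close> is block diagonal, they are the \<open>k1\<close> largest of \<open>T1\<close> and the \<open>k2\<close> largest of \<open>T2\<close>.
\<close>

section \<open>Diagonalization of real symmetric matrices\<close>

text \<open>The characteristic polynomial has a complex root \<open>z\<close>. Pairing an
  eigenvector \<open>v\<close> with its conjugate \<open>?w\<close>, symmetry evaluates
  \<open>?w \<bullet> (?C *\<^sub>v v)\<close> both as \<open>z\<close> and as \<open>cnj z\<close>
  times the nonzero number \<open>?w \<bullet> v\<close>, so \<open>z\<close> is real.\<close>

lemma symmetric_real_eigenvalue:
  fixes A :: "real mat"
  assumes A: "A \<in> carrier_mat n n" and sym: "transpose_mat A = A" and n: "n > 0"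
  obtains e where "eigenvalue A e"
proof -
  let ?C = "map_mat complex_of_real A"
  have C: "?C \<in> carrier_mat n n" using A by simp
  have Csym: "transpose_mat ?C = ?C"
    using sym by (metis map_mat_transpose)
  have "degree (char_poly ?C) = n" using degree_monic_char_poly[OF C] by simp
  then obtain z where z: "poly (char_poly ?C) z = 0"
    using n fundamental_theorem_of_algebra[of "char_poly ?C"] by (auto simp: constant_degree)
  then have "eigenvalue ?C z" using eigenvalue_root_char_poly[OF C] by simp
  then obtain v where v: "v \<in> carrier_vec n" "v \<noteq> 0\<^sub>v n" and ev: "?C *\<^sub>v v = z \<cdot>\<^sub>v v"
    using C unfolding eigenvalue_def eigenvector_def by auto
  let ?w = "conjugate v"
  have w: "?w \<in> carrier_vec n" using v by simp
  have evw: "?C *\<^sub>v ?w = cnj z \<cdot>\<^sub>v ?w"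
  proof (rule eq_vecI)
    fix i assume "i < dim_vec (cnj z \<cdot>\<^sub>v ?w)"
    then have i: "i < n" using v by simp
    have "(?C *\<^sub>v ?w) $ i = cnj ((?C *\<^sub>v v) $ i)"
      using i v A by (simp add: scalar_prod_def)
    also have "\<dots> = (cnj z \<cdot>\<^sub>v ?w) $ i" unfolding ev using i v by simp
    finally show "(?C *\<^sub>v ?w) $ i = (cnj z \<cdot>\<^sub>v ?w) $ i" .
  qed (use v A in auto)
  have "(?C *\<^sub>v ?w) \<bullet> v = ?w \<bullet> (?C *\<^sub>v v)"
    using transpose_vec_mult_scalar[OF C v(1) w] Csym by simp
  then have "cnj z * (?w \<bullet> v) = z * (?w \<bullet> v)"
    unfolding ev evw using v w by simp
  moreover have "?w \<bullet> v \<noteq> 0"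
    using v conjugate_square_eq_0_vec[OF v(1)] comm_scalar_prod[OF v(1) w] by simp
  ultimately have "cnj z = z" by simp
  then have "z = of_real (Re z)" by (simp add: complex_eq_iff)
  then have "complex_of_real (poly (char_poly A) (Re z)) = 0"
    using z by (metis of_real_hom.char_poly_hom[OF A] of_real_hom.poly_map_poly)
  then have "eigenvalue A (Re z)" using eigenvalue_root_char_poly[OF A] by simp
  then show ?thesis by (rule that)
qed

text \<open>Supplies the deflation step of the spectral theorem: an eigenvector is completed to a
  basis, and Gram-Schmidt leaves the first basis vector unchanged.\<close>

lemma orthogonal_mat_with_eigenvector:
  fixes A :: "real mat"
  assumes A: "A \<in> carrier_mat n n" and e: "eigenvalue A e"
  obtains W where "W \<in> carrier_mat n n" "transpose_mat W * W = 1\<^sub>m n" "A *\<^sub>v col W 0 = e \<cdot>\<^sub>v col W 0"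
proof -
  obtain v where v: "v \<in> carrier_vec n" "v \<noteq> 0\<^sub>v n" and ev: "A *\<^sub>v v = e \<cdot>\<^sub>v v"
    using A e unfolding eigenvalue_def eigenvector_def by auto
  interpret cof_vec_space n "TYPE(real)" .
  define ws where "ws = gram_schmidt n (basis_completion v)"
  note b = basis_completion[OF v]
  have b0: "basis_completion v = v # tl (basis_completion v)"
    using b(7) unfolding basis_completion_def Let_def by simp
  note gs = gram_schmidt_result[OF b(2) b(4) b(5) ws_def]
  have len: "length ws = n" using gs(4) b(6) by simp
  have n: "n > 0" using v by (cases n) auto
  have ws0: "ws ! 0 = v"
    using gram_schmidt_hd[OF v(1), of "tl (basis_completion v)"] b0 len n ws_def
    by (metis hd_conv_nth length_greater_0_conv)
  have wsc: "ws ! i \<in> carrier_vec n" if "i < n" for i using that gs(3) len by auto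
  have cj: "conjugate w = w" for w :: "real vec" by (rule eq_vecI) auto
  have orth: "ws ! i \<bullet> ws ! j = 0 \<longleftrightarrow> i \<noteq> j" if "i < n" "j < n" for i j
    using corthogonalD[OF gs(2), of i j] that len cj by simp
  have pos: "ws ! i \<bullet> ws ! i > 0" if "i < n" for i
    using orth[OF that that] conjugate_square_ge_0_vec[of "ws ! i"] cj by (metis less_eq_real_def)
  \<comment> \<open>Gram-Schmidt only makes the vectors orthogonal, so each one is divided by its
    norm.\<close>
  define W where "W = mat_of_cols n (map (\<lambda>w. (1 / sqrt (w \<bullet> w)) \<cdot>\<^sub>v w) ws)"
  have W: "W \<in> carrier_mat n n" unfolding W_def using mat_of_cols_carrier(1)[of n] len by (metis length_map)
  have col: "col W i = (1 / sqrt (ws ! i \<bullet> ws ! i)) \<cdot>\<^sub>v (ws ! i)" if "i < n" for i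
    unfolding W_def using that len wsc by (subst col_mat_of_cols) auto
  show ?thesis
  proof (rule that[OF W])
    show "transpose_mat W * W = 1\<^sub>m n"
    proof (rule eq_matI)
      fix i j assume "i < dim_row (1\<^sub>m n :: real mat)" "j < dim_col (1\<^sub>m n :: real mat)"
      then have ij: "i < n" "j < n" by auto
      have "(transpose_mat W * W) $$ (i, j) = col W i \<bullet> col W j" using W ij by simp
      also have "\<dots> = (1 / sqrt (ws ! i \<bullet> ws ! i)) * (1 / sqrt (ws ! j \<bullet> ws ! j)) * (ws ! i \<bullet> ws ! j)"
        unfolding col[OF ij(1)] col[OF ij(2)] using wsc[OF ij(1)] wsc[OF ij(2)] by simp
      also have "\<dots> = (1\<^sub>m n) $$ (i, j)"
        using ij orth[OF ij] pos[OF ij(1)] by auto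
      finally show "(transpose_mat W * W) $$ (i, j) = (1\<^sub>m n) $$ (i, j)" .
    qed (use W in auto)
    show "A *\<^sub>v col W 0 = e \<cdot>\<^sub>v col W 0"
      unfolding col[OF n] ws0 using A v ev
      by (simp add: mult_mat_vec[OF A v(1)] smult_smult_assoc mult.commute)
  qed
qed

lemma mult_block_diag_mat:
  fixes A1 :: "'a :: semiring_0 mat"
  assumes "A1 \<in> carrier_mat m m" "A2 \<in> carrier_mat m m" "D1 \<in> carrier_mat n n" "D2 \<in> carrier_mat n n"
  shows "four_block_mat A1 (0\<^sub>m m n) (0\<^sub>m n m) D1 * four_block_mat A2 (0\<^sub>m m n) (0\<^sub>m n m) D2
    = four_block_mat (A1 * A2) (0\<^sub>m m n) (0\<^sub>m n m) (D1 * D2)"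
  using assms by (subst mult_four_block_mat[of _ m m _ n _ n]) auto

text \<open>Induction on the dimension. In an orthonormal basis that starts with an eigenvector, the
  first column holds only the eigenvalue; symmetry clears the first row as well and leaves a smaller
  symmetric block.\<close>

lemma real_spectral_theorem:
  fixes A :: "real mat"
  assumes "A \<in> carrier_mat n n" and "transpose_mat A = A"
  shows "\<exists>P f. P \<in> carrier_mat n n \<and> transpose_mat P * P = 1\<^sub>m n
    \<and> transpose_mat P * A * P = mat_diag n f"
  using assms
proof (induction n arbitrary: A)
  case 0
  then show ?case by (intro exI[of _ "1\<^sub>m 0"] exI[of _ "\<lambda>_. 0"]) (auto intro!: eq_matI simp: mat_diag_def)
next
  case (Suc n)
  note A = Suc.prems(1) and sym = Suc.prems(2)
  obtain e where "eigenvalue A e" using symmetric_real_eigenvalue[OF A sym] by auto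
  then obtain W where W: "W \<in> carrier_mat (Suc n) (Suc n)" and WW: "transpose_mat W * W = 1\<^sub>m (Suc n)"
    and ev: "A *\<^sub>v col W 0 = e \<cdot>\<^sub>v col W 0"
    using orthogonal_mat_with_eigenvector[OF A] by blast
  define B where "B = transpose_mat W * A * W"
  define M where "M = mat n n (\<lambda>(i, j). B $$ (Suc i, Suc j))"
  define E where "E = mat 1 1 (\<lambda>_. e)"
  have M: "M \<in> carrier_mat n n" and E: "E \<in> carrier_mat 1 1" by (auto simp: M_def E_def)
  have Wt: "transpose_mat W \<in> carrier_mat (Suc n) (Suc n)" using W by simp
  have B: "B \<in> carrier_mat (Suc n) (Suc n)" using A W by (simp add: B_def)
  have Bsym: "transpose_mat B = B"
    using A W sym by (simp add: B_def transpose_mult[of _ "Suc n" "Suc n" _ "Suc n"]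
        assoc_mult_mat[of _ "Suc n" "Suc n" _ "Suc n" _ "Suc n"])
  have Bs: "B $$ (i, j) = B $$ (j, i)" if "i < Suc n" "j < Suc n" for i j
    using that B by (metis Bsym carrier_matD index_transpose_mat(1))
  have B0: "B $$ (i, 0) = (if i = 0 then e else 0)" if "i < Suc n" for i
  proof -
    have "B $$ (i, 0) = col W i \<bullet> (A *\<^sub>v col W 0)"
      using that A W unfolding B_def
      by (subst assoc_mult_mat[of _ "Suc n" "Suc n" _ "Suc n" _ "Suc n"]) (auto simp: mult_mat_vec_def)
    also have "\<dots> = e * (transpose_mat W * W) $$ (i, 0)" unfolding ev using that W by simp
    also have "\<dots> = (if i = 0 then e else 0)" unfolding WW using that by simp
    finally show ?thesis .
  qed
  have block: "B = four_block_mat E (0\<^sub>m 1 n) (0\<^sub>m n 1) M"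
  proof (rule eq_matI)
    fix i j assume "i < dim_row (four_block_mat E (0\<^sub>m 1 n) (0\<^sub>m n 1) M)"
      "j < dim_col (four_block_mat E (0\<^sub>m 1 n) (0\<^sub>m n 1) M)"
    then have ij: "i < Suc n" "j < Suc n" using M E by auto
    show "B $$ (i, j) = four_block_mat E (0\<^sub>m 1 n) (0\<^sub>m n 1) M $$ (i, j)"
      using ij B0[of i] B0[of j] Bs[of 0 j] by (cases i; cases j) (auto simp: M_def E_def)
  qed (use B M E in auto)
  have "transpose_mat M = M" by (rule eq_matI) (use Bs in \<open>auto simp: M_def\<close>)
  then obtain Q f where Q: "Q \<in> carrier_mat n n" and QQ: "transpose_mat Q * Q = 1\<^sub>m n"
    and Qf: "transpose_mat Q * M * Q = mat_diag n f"
    using Suc.IH[OF M] by auto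
  have Qt: "transpose_mat Q \<in> carrier_mat n n" using Q by simp
  \<comment> \<open>\<open>R\<close> fixes the first coordinate and diagonalizes the lower block, so
    \<open>W * R\<close> diagonalizes \<open>A\<close>.\<close>
  define R where "R = four_block_mat (1\<^sub>m 1) (0\<^sub>m 1 n) (0\<^sub>m n 1) Q"
  have R: "R \<in> carrier_mat (Suc n) (Suc n)"
    using four_block_carrier_mat[of "1\<^sub>m 1" 1 1 Q n n] Q by (simp add: R_def)
  have Rt: "transpose_mat R = four_block_mat (1\<^sub>m 1) (0\<^sub>m 1 n) (0\<^sub>m n 1) (transpose_mat Q)"
    unfolding R_def using Q by (subst transpose_four_block_mat[of _ 1 1 _ n _ n]) auto
  have "transpose_mat R * R = four_block_mat (1\<^sub>m 1) (0\<^sub>m 1 n) (0\<^sub>m n 1) (1\<^sub>m n)"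
    unfolding Rt unfolding R_def by (subst mult_block_diag_mat) (use Q Qt QQ in auto)
  also have "\<dots> = 1\<^sub>m (Suc n)" by (rule eq_matI) auto
  finally have RR: "transpose_mat R * R = 1\<^sub>m (Suc n)" .
  have "transpose_mat R * B = four_block_mat E (0\<^sub>m 1 n) (0\<^sub>m n 1) (transpose_mat Q * M)"
    unfolding Rt block by (subst mult_block_diag_mat) (use Qt M E in auto)
  then have "transpose_mat R * B * R = four_block_mat E (0\<^sub>m 1 n) (0\<^sub>m n 1) (transpose_mat Q * M * Q)"
    unfolding R_def using mult_block_diag_mat[of E 1 "1\<^sub>m 1" "transpose_mat Q * M" n Q] E Q Qt M by simp
  also have "\<dots> = mat_diag (Suc n) (case_nat e f)"
    unfolding Qf E_def by (rule eq_matI) (auto simp: mat_diag_def split: nat.splits)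
  finally have RB: "transpose_mat R * B * R = mat_diag (Suc n) (case_nat e f)" .
  have Rtc: "transpose_mat R \<in> carrier_mat (Suc n) (Suc n)" using R by simp
  note assoc = assoc_mult_mat[of _ "Suc n" "Suc n" _ "Suc n" _ "Suc n"]
  have WRt: "transpose_mat (W * R) = transpose_mat R * transpose_mat W" by (rule transpose_mult[OF W R])
  have "transpose_mat (W * R) * (W * R) = transpose_mat R * (transpose_mat W * W) * R"
    unfolding WRt using W Wt R Rtc by (simp add: assoc)
  also have "\<dots> = 1\<^sub>m (Suc n)" unfolding WW using R Rtc RR by simp
  finally have 1: "transpose_mat (W * R) * (W * R) = 1\<^sub>m (Suc n)" .
  have "transpose_mat (W * R) * A * (W * R) = transpose_mat R * B * R"
    unfolding WRt B_def using A W Wt R Rtc by (simp add: assoc)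
  then have "transpose_mat (W * R) * A * (W * R) = mat_diag (Suc n) (case_nat e f)"
    unfolding RB .
  then show ?case using 1 W R by (intro exI[of _ "W * R"] exI[of _ "case_nat e f"]) auto
qed

section \<open>Eigenvalues and quadratic forms\<close>

text \<open>The columns of \<open>P\<close> are an orthonormal basis in which the form is diagonal,
  and \<open>?y\<close> holds the coordinates of \<open>x\<close> in that basis.\<close>

lemma quadratic_form_diagonalized:
  fixes A :: "real mat"
  assumes A: "A \<in> carrier_mat n n" and P: "P \<in> carrier_mat n n" and PP: "transpose_mat P * P = 1\<^sub>m n"
    and PAP: "transpose_mat P * A * P = mat_diag n f" and x: "x \<in> carrier_vec n"
  shows "x \<bullet> (A *\<^sub>v x) = (\<Sum>j<n. f j * (col P j \<bullet> x)\<^sup>2)"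
proof -
  let ?y = "transpose_mat P *\<^sub>v x"
  have Pt: "transpose_mat P \<in> carrier_mat n n" using P by simp
  have PP': "P * transpose_mat P = 1\<^sub>m n" using mat_mult_left_right_inverse[OF Pt P PP] .
  have y: "?y \<in> carrier_vec n" using Pt x by simp
  have xy: "P *\<^sub>v ?y = x" using P Pt x PP' by (simp flip: assoc_mult_mat_vec[OF P Pt x])
  have "x \<bullet> (A *\<^sub>v x) = (P *\<^sub>v ?y) \<bullet> (A *\<^sub>v (P *\<^sub>v ?y))" unfolding xy ..
  also have "\<dots> = ?y \<bullet> (transpose_mat P *\<^sub>v (A *\<^sub>v (P *\<^sub>v ?y)))"
    using transpose_vec_mult_scalar[OF Pt, of "A *\<^sub>v (P *\<^sub>v ?y)" ?y] A P y by simp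
  also have "transpose_mat P *\<^sub>v (A *\<^sub>v (P *\<^sub>v ?y)) = mat_diag n f *\<^sub>v ?y"
    unfolding PAP[symmetric] using A P Pt y
    by (simp add: assoc_mult_mat_vec[of _ n n _ n] assoc_mult_mat[of _ n n _ n])
  also have "?y \<bullet> (mat_diag n f *\<^sub>v ?y) = (\<Sum>j<n. ?y $ j * (mat_diag n f *\<^sub>v ?y) $ j)"
    using y unfolding scalar_prod_def by (simp add: mat_diag_def atLeast0LessThan)
  also have "\<dots> = (\<Sum>j<n. f j * (col P j \<bullet> x)\<^sup>2)"
  proof (rule sum.cong)
    fix j assume j: "j \<in> {..<n}"
    have "(mat_diag n f *\<^sub>v ?y) $ j = (\<Sum>i<n. (if j = i then f i else 0) * ?y $ i)"
      using y j P by (simp add: mat_diag_def scalar_prod_def atLeast0LessThan)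
    also have "\<dots> = f j * ?y $ j" using j by (simp add: if_distrib[of "\<lambda>a. a * _"] cong: if_cong)
    finally show "?y $ j * (mat_diag n f *\<^sub>v ?y) $ j = f j * (col P j \<bullet> x)\<^sup>2"
      using j P by (simp add: power2_eq_square)
  qed simp
  finally show ?thesis .
qed

lemma orthogonal_parseval:
  fixes P :: "real mat"
  assumes P: "P \<in> carrier_mat n n" and PP: "transpose_mat P * P = 1\<^sub>m n" and x: "x \<in> carrier_vec n"
  shows "(\<Sum>j<n. (col P j \<bullet> x)\<^sup>2) = x \<bullet> x"
  using quadratic_form_diagonalized[of "1\<^sub>m n" n P "\<lambda>_. 1" x] assms by simp

lemma orthogonal_col_norm:
  fixes P :: "real mat"
  assumes P: "P \<in> carrier_mat n n" and PP: "transpose_mat P * P = 1\<^sub>m n" and i: "i < n"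
  shows "col P i \<bullet> col P i = 1"
proof -
  have "col P i \<bullet> col P i = (transpose_mat P * P) $$ (i, i)" using P i by simp
  then show ?thesis using i unfolding PP by simp
qed

lemma proots_prod_linear: "proots (\<Prod>a\<leftarrow>as. [:- a, 1:]) = mset (as :: real list)"
proof (induction as)
  case (Cons a as)
  have "(\<Prod>a\<leftarrow>as. [:- a, 1:]) \<noteq> 0" by auto
  then show ?case using Cons by (simp add: proots_mult del: mult_pCons_left)
qed simp

text \<open>Similar matrices share the characteristic polynomial, and that of a diagonal matrix is a
  product of linear factors, so multiplicities are counted correctly.\<close>

lemma proots_char_poly_diagonalized:
  fixes A :: "real mat"
  assumes A: "A \<in> carrier_mat n n" and P: "P \<in> carrier_mat n n" and PP: "transpose_mat P * P = 1\<^sub>m n"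
    and PAP: "transpose_mat P * A * P = mat_diag n f"
  shows "proots (char_poly A) = image_mset f (mset_set {..<n})"
proof -
  have Pt: "transpose_mat P \<in> carrier_mat n n" using P by simp
  have PP': "P * transpose_mat P = 1\<^sub>m n" using mat_mult_left_right_inverse[OF Pt P PP] .
  have "similar_mat_wit (mat_diag n f) A (transpose_mat P) P"
    by (rule similar_mat_witI[of _ _ n]) (use A P Pt PP PP' PAP in auto)
  then have "char_poly A = char_poly (mat_diag n f)"
    using char_poly_similar unfolding similar_mat_def by metis
  also have "\<dots> = (\<Prod>a\<leftarrow>diag_mat (mat_diag n f). [:- a, 1:])"
    by (rule char_poly_upper_triangular[of _ n]) (auto simp: mat_diag_def upper_triangular_def)
  finally have "proots (char_poly A) = mset (diag_mat (mat_diag n f))"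
    by (simp only: proots_prod_linear)
  also have "diag_mat (mat_diag n f) = map f [0..<n]" by (auto simp: diag_mat_def mat_diag_def)
  finally show ?thesis by (simp only: mset_map mset_upt atLeast0LessThan)
qed

text \<open>A diagonal entry is the quadratic form at a unit vector. Summed over all unit vectors,
  each eigenvalue is weighted by the squared norm of its eigenvector, which is 1.\<close>

lemma sum_proots_char_poly_eq_trace:
  fixes A :: "real mat"
  assumes A: "A \<in> carrier_mat n n" and sym: "transpose_mat A = A"
  shows "\<Sum>\<^sub># (proots (char_poly A)) = (\<Sum>i<n. A $$ (i, i))"
proof -
  obtain P f where P: "P \<in> carrier_mat n n" and PP: "transpose_mat P * P = 1\<^sub>m n"
    and PAP: "transpose_mat P * A * P = mat_diag n f"
    using real_spectral_theorem[OF assms] by blast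
  have "A $$ (i, i) = (\<Sum>j<n. f j * (col P j $ i)\<^sup>2)" if i: "i < n" for i
  proof -
    have "A $$ (i, i) = unit_vec n i \<bullet> (A *\<^sub>v unit_vec n i)" using A i by simp
    also have "\<dots> = (\<Sum>j<n. f j * (col P j \<bullet> unit_vec n i)\<^sup>2)"
      by (rule quadratic_form_diagonalized[OF A P PP PAP]) simp
    also have "\<dots> = (\<Sum>j<n. f j * (col P j $ i)\<^sup>2)" using P i by simp
    finally show ?thesis .
  qed
  then have "(\<Sum>i<n. A $$ (i, i)) = (\<Sum>i<n. \<Sum>j<n. f j * (col P j $ i)\<^sup>2)" by simp
  also have "\<dots> = (\<Sum>j<n. f j * (\<Sum>i<n. (col P j $ i)\<^sup>2))"
    by (subst sum.swap) (simp add: sum_distrib_left)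
  also have "\<dots> = (\<Sum>j<n. f j * (col P j \<bullet> col P j))"
    using P by (auto simp: scalar_prod_def power2_eq_square atLeast0LessThan)
  also have "\<dots> = (\<Sum>j<n. f j)" using orthogonal_col_norm[OF P PP] by simp
  finally show ?thesis by (simp add: proots_char_poly_diagonalized[OF A P PP PAP] sum_unfold_sum_mset)
qed

lemma size_proots_char_poly_symmetric:
  fixes A :: "real mat"
  assumes A: "A \<in> carrier_mat n n" and sym: "transpose_mat A = A"
  shows "size (proots (char_poly A)) = n"
proof -
  obtain P f where P: "P \<in> carrier_mat n n" and PP: "transpose_mat P * P = 1\<^sub>m n"
    and PAP: "transpose_mat P * A * P = mat_diag n f"
    using real_spectral_theorem[OF assms] by blast
  show ?thesis by (simp add: proots_char_poly_diagonalized[OF A P PP PAP])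
qed

text \<open>
  The easy half of Ky Fan's principle: the squared inner products of the two orthonormal eigenbases
  form a doubly stochastic matrix, so the selected eigenvectors of \<open>A\<close> put weight at most 1 on each
  eigenvector of \<open>B\<close>.
\<close>

lemma sum_selected_eigenvalues_le:
  fixes A B :: "real mat"
  assumes A: "A \<in> carrier_mat n n" "transpose_mat A = A" and B: "B \<in> carrier_mat n n" "transpose_mat B = B"
    and le: "\<And>x. x \<in> carrier_vec n \<Longrightarrow> x \<bullet> (A *\<^sub>v x) \<le> x \<bullet> (B *\<^sub>v x)"
  shows "(\<Sum>\<mu>\<in>#filter_mset S (proots (char_poly A)). \<mu> - d) \<le> (\<Sum>\<mu>\<in>#proots (char_poly B). max (\<mu> - d) 0)"
proof -
  obtain P f where P: "P \<in> carrier_mat n n" "transpose_mat P * P = 1\<^sub>m n"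
    and f: "transpose_mat P * A * P = mat_diag n f"
    using real_spectral_theorem[OF A] by blast
  obtain Q g where Q: "Q \<in> carrier_mat n n" "transpose_mat Q * Q = 1\<^sub>m n"
    and g: "transpose_mat Q * B * Q = mat_diag n g"
    using real_spectral_theorem[OF B] by blast
  let ?w = "\<lambda>i j. (col Q j \<bullet> col P i)\<^sup>2"
  let ?I = "{i \<in> {..<n}. S (f i)}"
  have cP: "col P i \<in> carrier_vec n" and cQ: "col Q i \<in> carrier_vec n" for i using P Q by auto
  have row: "(\<Sum>j<n. ?w i j) = 1" if "i < n" for i
    using orthogonal_parseval[OF Q cP] orthogonal_col_norm[OF P that] by simp
  have column: "(\<Sum>i<n. ?w i j) = 1" if "j < n" for j
    using orthogonal_parseval[OF P cQ, of j] orthogonal_col_norm[OF Q that]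
      comm_scalar_prod[OF cP cQ] by simp
  have fA: "f i = col P i \<bullet> (A *\<^sub>v col P i)" if i: "i < n" for i
  proof -
    have "col P i \<bullet> (A *\<^sub>v col P i) = (transpose_mat P * A * P) $$ (i, i)"
      using A P i by (subst assoc_mult_mat[of _ n n _ n _ n]) (auto simp: mult_mat_vec_def)
    then show ?thesis using i unfolding f by (simp add: mat_diag_def)
  qed
  have "f i - d \<le> (\<Sum>j<n. (g j - d) * ?w i j)" if i: "i < n" for i
  proof -
    have "f i \<le> (\<Sum>j<n. g j * ?w i j)"
      using fA[OF i] le[OF cP] quadratic_form_diagonalized[OF B(1) Q g cP] by metis
    moreover have "d = (\<Sum>j<n. d * ?w i j)" using row[OF i] by (simp flip: sum_distrib_left)
    ultimately show ?thesis by (simp add: left_diff_distrib sum_subtractf)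
  qed
  then have "(\<Sum>i\<in>?I. f i - d) \<le> (\<Sum>i\<in>?I. \<Sum>j<n. (g j - d) * ?w i j)"
    by (intro sum_mono) auto
  also have "\<dots> = (\<Sum>j<n. (g j - d) * (\<Sum>i\<in>?I. ?w i j))"
    by (subst sum.swap) (simp add: sum_distrib_left)
  also have "\<dots> \<le> (\<Sum>j<n. max (g j - d) 0)"
  proof (intro sum_mono)
    fix j assume "j \<in> {..<n}"
    then have "(\<Sum>i\<in>?I. ?w i j) \<le> 1"
      using column[of j] sum_mono2[of "{..<n}" ?I "\<lambda>i. ?w i j"] by auto
    moreover have "(\<Sum>i\<in>?I. ?w i j) \<ge> 0" by (intro sum_nonneg) auto
    \<comment> \<open>A nonnegative weight permits the passage to the positive part, and a weight of
      at most 1 can then be replaced by 1.\<close>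
    ultimately have "(g j - d) * (\<Sum>i\<in>?I. ?w i j) \<le> max (g j - d) 0 * (\<Sum>i\<in>?I. ?w i j)"
      "max (g j - d) 0 * (\<Sum>i\<in>?I. ?w i j) \<le> max (g j - d) 0 * 1"
      by (intro mult_right_mono mult_left_mono; simp)+
    then show "(g j - d) * (\<Sum>i\<in>?I. ?w i j) \<le> max (g j - d) 0" by simp
  qed
  finally show ?thesis
    by (simp add: proots_char_poly_diagonalized[OF A(1) P f] proots_char_poly_diagonalized[OF B(1) Q g]
        filter_mset_image_mset image_mset.compositionality comp_def sum_unfold_sum_mset)
qed

section \<open>Characteristic polynomials under reordering and block decomposition\<close>

lemma char_poly_permute:
  fixes A :: "'a :: comm_ring_1 mat"
  assumes A: "A \<in> carrier_mat n n" and p: "p permutes {0..<n}"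
  shows "char_poly (mat n n (\<lambda>(i, j). A $$ (p i, p j))) = char_poly A"
proof -
  let ?C = "char_poly_matrix A"
  let ?R = "mat n n (\<lambda>(i, j). ?C $$ (p i, j))"
  have C: "?C \<in> carrier_mat n n" using A by simp
  have p': "p i < n" if "i < n" for i using permutes_in_image[OF p, of i] that by auto
  have inj: "p i = p j \<longleftrightarrow> i = j" for i j using permutes_inj[OF p] by (auto dest: injD)
  \<comment> \<open>Columns are permuted as rows of the transpose. The two permutations contribute
    the sign of \<open>p\<close> twice, and its square is 1.\<close>
  have 1: "char_poly_matrix (mat n n (\<lambda>(i, j). A $$ (p i, p j)))
      = transpose_mat (mat n n (\<lambda>(i, j). transpose_mat ?R $$ (p i, j)))"
    by (rule eq_matI) (use A in \<open>auto simp: char_poly_matrix_def p' inj\<close>)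
  have "char_poly (mat n n (\<lambda>(i, j). A $$ (p i, p j))) = signof p * (signof p * det ?C)"
    unfolding char_poly_def 1
    by (subst det_transpose[of _ n]; (subst det_permute_rows[OF _ p])?; (subst det_transpose[of _ n])?; (subst det_permute_rows[OF C p])?; simp)
  also have "\<dots> = char_poly A" unfolding char_poly_def by (simp add: sign_def)
  finally show ?thesis .
qed

lemma char_poly_block_diag:
  fixes A :: "'a :: idom mat"
  assumes A: "A \<in> carrier_mat n n" and B: "B \<in> carrier_mat m m"
  shows "char_poly (four_block_mat A (0\<^sub>m n m) (0\<^sub>m m n) B) = char_poly A * char_poly B"
proof -
  have "char_poly_matrix (four_block_mat A (0\<^sub>m n m) (0\<^sub>m m n) B)
    = four_block_mat (char_poly_matrix A) (0\<^sub>m n m) (0\<^sub>m m n) (char_poly_matrix B)"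
    by (rule eq_matI) (use A B in \<open>auto simp: char_poly_matrix_def\<close>)
  then show ?thesis unfolding char_poly_def
    using det_four_block_mat_lower_left_zero[of "char_poly_matrix A" n "0\<^sub>m n m" m _ "char_poly_matrix B"] A B by simp
qed

section \<open>The Laplacian spectrum\<close>

lemma vert_list:
  assumes "finite (verts G)"
  shows "distinct (vert_list G)" "set (vert_list G) = verts G" "length (vert_list G) = card (verts G)"
proof -
  have "\<exists>vs. distinct vs \<and> set vs = verts G" using finite_distinct_list[OF assms] by blast
  from someI_ex[OF this] show "distinct (vert_list G)" "set (vert_list G) = verts G"
    by (auto simp: vert_list_def)
  then show "length (vert_list G) = card (verts G)" using distinct_card by metis
qed

text \<open>
  With the listing as a parameter, the Laplacian matrix of a disconnected graph becomes
  block diagonal once the vertices are listed component by component.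
\<close>

definition list_laplacian :: "('a, 'b) pre_digraph \<Rightarrow> 'a list \<Rightarrow> real mat" where
  "list_laplacian G vs = mat (length vs) (length vs) (\<lambda>(i, j).
     (if i = j then real (out_degree G (vs ! i)) else 0) - (if vs ! i \<rightarrow>\<^bsub>G\<^esub> vs ! j then 1 else 0))"

lemma laplacian_matrix_eq_list_laplacian:
  assumes "finite (verts G)"
  shows "laplacian_matrix G = list_laplacian G (vert_list G)"
  by (rule eq_matI) (auto simp: laplacian_matrix_def degree_matrix_def adjacency_matrix_def
      list_laplacian_def vert_list[OF assms])

text \<open>The two listings differ by a permutation, which acts on rows and columns alike. This
  frees the characteristic polynomial from the arbitrary choice in \<open>vert_list\<close>.\<close>

lemma char_poly_list_laplacian_cong:
  assumes "distinct vs" "distinct ws" "set vs = set ws"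
  shows "char_poly (list_laplacian G vs) = char_poly (list_laplacian G ws)"
proof -
  have "mset vs = mset ws" using assms by (simp add: set_eq_iff_mset_eq_distinct)
  then obtain p where p: "p permutes {..<length ws}" and vs: "permute_list p ws = vs"
    by (rule mset_eq_permutation)
  have len: "length vs = length ws" using vs by auto
  have p': "p i < length ws" if "i < length ws" for i using permutes_in_image[OF p, of i] that by auto
  have inj: "p i = p j \<longleftrightarrow> i = j" for i j using permutes_inj[OF p] by (auto dest: injD)
  have nth: "vs ! i = ws ! p i" if "i < length ws" for i
    using permute_list_nth[OF p that] vs by simp
  have "list_laplacian G vs = mat (length ws) (length ws) (\<lambda>(i, j). list_laplacian G ws $$ (p i, p j))"
    by (rule eq_matI) (auto simp: list_laplacian_def len nth p' inj)
  then show ?thesis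
    using char_poly_permute[of "list_laplacian G ws" "length ws" p] p
    by (simp add: list_laplacian_def atLeast0LessThan)
qed

lemma laplacian_matrix_carrier: "laplacian_matrix G \<in> carrier_mat (card (verts G)) (card (verts G))"
  by (rule carrier_matI) (simp_all add: laplacian_matrix_def degree_matrix_def adjacency_matrix_def)

lemma (in graph) adj_commute: "u \<rightarrow>\<^bsub>G\<^esub> v \<longleftrightarrow> v \<rightarrow>\<^bsub>G\<^esub> u"
  using graph_symmetric by blast

lemma (in graph) symmetric_laplacian_matrix: "transpose_mat (laplacian_matrix G) = laplacian_matrix G"
  by (rule eq_matI)
    (auto simp: laplacian_matrix_def degree_matrix_def adjacency_matrix_def adj_commute)

section \<open>Edge count, trace and energy\<close>

lemma (in graph) card_arcs_eq: "card (arcs G) = 2 * card (edges G)"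
proof -
  let ?f = "\<lambda>a. {tail G a, head G a}"
  \<comment> \<open>The fibre over an edge is an arc and its opposite: symmetry supplies the second
    arc, the absence of parallel arcs excludes a third, and the absence of loops keeps the two
    apart.\<close>
  have two: "card {a \<in> arcs G. ?f a = s} = 2" if s: "s \<in> ?f ` arcs G" for s
  proof -
    obtain b where b: "b \<in> arcs G" "s = ?f b" using s by auto
    obtain c where c: "c \<in> arcs G" "tail G b = head G c" "head G b = tail G c"
      using sym_arcs b(1) unfolding symmetric_conv by blast
    have "{a \<in> arcs G. ?f a = s} = {b, c}"
      using b c no_multi_arcs by (fastforce simp: arc_to_ends_def doubleton_eq_iff)
    moreover have "b \<noteq> c" using c no_loops by auto
    ultimately show ?thesis by simp
  qed
  have "card (arcs G) = (\<Sum>a\<in>arcs G. 1)" by simp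
  also have "\<dots> = (\<Sum>s\<in>?f ` arcs G. \<Sum>a\<in>{a \<in> arcs G. ?f a = s}. 1)"
    by (rule sum.image_gen) simp
  also have "\<dots> = (\<Sum>s\<in>?f ` arcs G. 2)" using two by (intro sum.cong) auto
  finally show ?thesis by (simp add: edges_def)
qed

lemma (in graph) sum_vert_list:
  fixes f :: "'a \<Rightarrow> real"
  shows "(\<Sum>i<card (verts G). f (vert_list G ! i)) = (\<Sum>v\<in>verts G. f v)"
proof -
  note vl = vert_list[OF finite_verts]
  have "bij_betw (\<lambda>i. vert_list G ! i) {..<card (verts G)} (verts G)"
    by (rule bij_betw_nth) (simp_all only: vl)
  then show ?thesis by (rule sum.reindex_bij_betw)
qed

text \<open>The sum is the trace. Without loops the diagonal entries are the degrees, and these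
  count every arc once, at its tail.\<close>

lemma (in graph) sum_mset_laplacian_spectrum: "\<Sum>\<^sub># (laplacian_spectrum G) = 2 * real (card (edges G))"
proof -
  let ?n = "card (verts G)"
  note vl = vert_list[OF finite_verts]
  have "\<Sum>\<^sub># (laplacian_spectrum G) = (\<Sum>i<?n. laplacian_matrix G $$ (i, i))"
    unfolding laplacian_spectrum_def
    by (rule sum_proots_char_poly_eq_trace[OF laplacian_matrix_carrier symmetric_laplacian_matrix])
  also have "\<dots> = (\<Sum>i<?n. real (out_degree G (vert_list G ! i)))"
    by (intro sum.cong) (auto simp: laplacian_matrix_def degree_matrix_def adjacency_matrix_def dest: adj_not_same)
  also have "\<dots> = (\<Sum>v\<in>verts G. real (out_degree G v))" by (rule sum_vert_list)
  also have "\<dots> = real (\<Sum>v\<in>verts G. \<Sum>a\<in>{a \<in> arcs G. tail G a = v}. 1)"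
    by (simp add: out_degree_def out_arcs_def)
  also have "(\<Sum>v\<in>verts G. \<Sum>a\<in>{a \<in> arcs G. tail G a = v}. 1) = (\<Sum>a\<in>arcs G. 1::nat)"
    by (rule sum.group) auto
  finally show ?thesis using card_arcs_eq by simp
qed

lemma (in graph) size_laplacian_spectrum: "size (laplacian_spectrum G) = card (verts G)"
  unfolding laplacian_spectrum_def
  by (rule size_proots_char_poly_symmetric[OF laplacian_matrix_carrier symmetric_laplacian_matrix])

lemma sum_mset_subtractf: "(\<Sum>x\<in>#M. f x - g x) = (\<Sum>x\<in>#M. f x) - (\<Sum>x\<in>#M. g x)"
  for f g :: "'a \<Rightarrow> real"
proof (induction M)
  case (add x M)
  then show ?case by simp
qed simp

text \<open>The average degree is the mean of the spectrum, so the deviations sum to 0 and their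
  positive parts make up half of the absolute values.\<close>

lemma (in graph) laplacian_energy_eq:
  "laplacian_energy G = 2 * (\<Sum>\<mu>\<in>#laplacian_spectrum G. max (\<mu> - avg_degree G) 0)"
proof -
  let ?d = "avg_degree G" and ?M = "laplacian_spectrum G"
  have eq: "\<bar>\<mu> - ?d\<bar> = 2 * max (\<mu> - ?d) 0 - (\<mu> - ?d)" for \<mu> by (auto simp: max_def)
  have "(\<Sum>\<mu>\<in>#?M. \<mu> - ?d) = \<Sum>\<^sub># ?M - real (size ?M) * ?d"
    by (simp add: sum_mset_subtractf)
  also have "\<dots> = 0"
    using sum_mset_laplacian_spectrum size_laplacian_spectrum by (auto simp: avg_degree_def edges_def)
  finally have 0: "(\<Sum>\<mu>\<in>#?M. \<mu> - ?d) = 0" .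
  show ?thesis unfolding laplacian_energy_def eq sum_mset_subtractf[of "\<lambda>\<mu>. 2 * max (\<mu> - ?d) 0"] 0
    by (simp only: sum_mset_distrib_left diff_0_right)
qed

section \<open>The Laplacian as a quadratic form\<close>

lemma (in graph) out_degree_eq_sum:
  "real (out_degree G v) = (\<Sum>w\<in>verts G. if v \<rightarrow> w then 1 else 0)"
proof -
  have "inj_on (head G) (out_arcs G v)"
    by (rule inj_onI) (auto intro: no_multi_arcs simp: arc_to_ends_def)
  moreover have "head G ` out_arcs G v = {w \<in> verts G. v \<rightarrow> w}"
    by (auto simp: arcs_ends_conv)
  ultimately have "out_degree G v = card {w \<in> verts G. v \<rightarrow> w}"
    unfolding out_degree_def by (metis card_image)
  then show ?thesis by (simp add: sum.If_cases Int_def)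
qed

text \<open>Expanding each degree as a row sum of the adjacency matrix puts both parts of the
  Laplacian over the same ordered pairs. Every edge occurs as two such pairs, hence the division by
  2.\<close>

lemma (in graph) laplacian_quadratic_form:
  assumes x: "x \<in> carrier_vec (card (verts G))"
  shows "x \<bullet> (laplacian_matrix G *\<^sub>v x) = (\<Sum>i<card (verts G). \<Sum>j<card (verts G).
     if vert_list G ! i \<rightarrow> vert_list G ! j then (x $ i - x $ j)\<^sup>2 else 0) / 2"
proof -
  let ?n = "card (verts G)"
  let ?a = "\<lambda>i j. if vert_list G ! i \<rightarrow> vert_list G ! j then 1 else 0 :: real"
  let ?d = "\<lambda>i. real (out_degree G (vert_list G ! i))"
  have d: "?d i = (\<Sum>j<?n. ?a i j)" for i
    unfolding out_degree_eq_sum by (rule sum_vert_list[symmetric])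
  have sym: "?a i j = ?a j i" for i j by (simp add: adj_commute)
  have "x \<bullet> (laplacian_matrix G *\<^sub>v x)
      = (\<Sum>i<?n. x $ i * (\<Sum>j<?n. ((if i = j then ?d i else 0) - ?a i j) * x $ j))"
    using x by (auto simp: scalar_prod_def laplacian_matrix_def degree_matrix_def adjacency_matrix_def
        atLeast0LessThan intro!: sum.cong)
  also have "\<dots> = (\<Sum>i<?n. ?d i * (x $ i)\<^sup>2 - (\<Sum>j<?n. ?a i j * (x $ i * x $ j)))"
  proof (rule sum.cong)
    fix i assume i: "i \<in> {..<?n}"
    have "(\<Sum>j<?n. ((if i = j then ?d i else 0) - ?a i j) * x $ j)
      = (\<Sum>j<?n. (if i = j then ?d i * x $ j else 0)) - (\<Sum>j<?n. ?a i j * x $ j)"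
      unfolding sum_subtractf[symmetric] by (rule sum.cong) (auto simp: left_diff_distrib)
    also have "(\<Sum>j<?n. (if i = j then ?d i * x $ j else 0)) = ?d i * x $ i" using i by simp
    finally show "x $ i * (\<Sum>j<?n. ((if i = j then ?d i else 0) - ?a i j) * x $ j)
      = ?d i * (x $ i)\<^sup>2 - (\<Sum>j<?n. ?a i j * (x $ i * x $ j))"
      by (simp only: right_diff_distrib sum_distrib_left power2_eq_square) (simp add: ac_simps)
  qed simp
  also have "\<dots> = (\<Sum>i<?n. \<Sum>j<?n. ?a i j * (x $ i)\<^sup>2) - (\<Sum>i<?n. \<Sum>j<?n. ?a i j * (x $ i * x $ j))"
    unfolding d by (simp only: sum_subtractf sum_distrib_right)
  finally have 1: "x \<bullet> (laplacian_matrix G *\<^sub>v x)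
    = (\<Sum>i<?n. \<Sum>j<?n. ?a i j * (x $ i)\<^sup>2) - (\<Sum>i<?n. \<Sum>j<?n. ?a i j * (x $ i * x $ j))" .
  have 2: "(\<Sum>i<?n. \<Sum>j<?n. ?a i j * (x $ i)\<^sup>2) = (\<Sum>i<?n. \<Sum>j<?n. ?a i j * (x $ j)\<^sup>2)"
    by (subst sum.swap) (simp only: sym)
  have "(\<Sum>i<?n. \<Sum>j<?n. if vert_list G ! i \<rightarrow> vert_list G ! j then (x $ i - x $ j)\<^sup>2 else 0)
    = (\<Sum>i<?n. \<Sum>j<?n. ?a i j * (x $ i)\<^sup>2 + ?a i j * (x $ j)\<^sup>2 - 2 * (?a i j * (x $ i * x $ j)))"
    by (intro sum.cong) (auto simp: power2_diff)
  also have "\<dots> = (\<Sum>i<?n. \<Sum>j<?n. ?a i j * (x $ i)\<^sup>2) + (\<Sum>i<?n. \<Sum>j<?n. ?a i j * (x $ j)\<^sup>2)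
      - 2 * (\<Sum>i<?n. \<Sum>j<?n. ?a i j * (x $ i * x $ j))"
    by (simp only: sum_subtractf sum.distrib sum_distrib_left)
  finally show ?thesis using 1 2 by simp
qed

text \<open>Adjacent pairs contribute squares, so losing some of them cannot increase the
  form.\<close>

lemma laplacian_quadratic_form_mono:
  assumes "graph G" "graph H" and verts: "verts H = verts G" and arcs: "arcs_ends H \<subseteq> arcs_ends G"
    and x: "x \<in> carrier_vec (card (verts G))"
  shows "x \<bullet> (laplacian_matrix H *\<^sub>v x) \<le> x \<bullet> (laplacian_matrix G *\<^sub>v x)"
proof -
  interpret G: graph G by fact
  interpret H: graph H by fact
  \<comment> \<open>The chosen listing depends on the vertex set alone, so both matrices use the
    same coordinates.\<close>
  have vl: "vert_list H = vert_list G" unfolding vert_list_def verts ..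
  have xH: "x \<in> carrier_vec (card (verts H))" using x verts by simp
  show ?thesis
    unfolding G.laplacian_quadratic_form[OF x] H.laplacian_quadratic_form[OF xH] vl verts
    by (intro divide_right_mono sum_mono) (use arcs in auto)
qed

lemma sum_selected_laplacian_le:
  assumes G: "graph G" and H: "graph H" and verts: "verts H = verts G" and arcs: "arcs_ends H \<subseteq> arcs_ends G"
  shows "2 * (\<Sum>\<mu>\<in>#filter_mset S (laplacian_spectrum H). \<mu> - avg_degree G) \<le> laplacian_energy G"
proof -
  have "(\<Sum>\<mu>\<in>#filter_mset S (laplacian_spectrum H). \<mu> - avg_degree G)
      \<le> (\<Sum>\<mu>\<in>#laplacian_spectrum G. max (\<mu> - avg_degree G) 0)"
    unfolding laplacian_spectrum_def
  proof (rule sum_selected_eigenvalues_le[OF _ graph.symmetric_laplacian_matrix[OF H]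
        laplacian_matrix_carrier graph.symmetric_laplacian_matrix[OF G]])
    show "laplacian_matrix H \<in> carrier_mat (card (verts G)) (card (verts G))"
      using laplacian_matrix_carrier[of H] verts by simp
  qed (rule laplacian_quadratic_form_mono[OF assms])
  then show ?thesis unfolding graph.laplacian_energy_eq[OF G] by (rule mult_left_mono) simp
qed

section \<open>Selecting eigenvalues by a threshold and splitting them by component\<close>

lemma take_filter_ge:
  fixes c :: "'a :: linorder"
  assumes "sorted_wrt (\<ge>) xs"
  shows "take (length (filter (\<lambda>x. c \<le> x) xs)) xs = filter (\<lambda>x. c \<le> x) xs"
  using assms
proof (induction xs)
  case (Cons x xs)
  show ?case
  proof (cases "c \<le> x")
    case False
    then have "filter (\<lambda>x. c \<le> x) xs = []" using Cons.prems by (auto simp: filter_empty_conv)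
    then show ?thesis using False by simp
  qed (use Cons in simp)
qed simp

text \<open>The eigenvalues reaching the threshold form a prefix of the nonincreasing list; all ties
  at \<open>c\<close> belong to it.\<close>

lemma sum_largest_num_eigenvalues_ge:
  "sum_largest (num_eigenvalues_ge c G) G = \<Sum>\<^sub># {#\<mu> \<in># laplacian_spectrum G. c \<le> \<mu>#}"
proof -
  let ?xs = "laplacian_eigenvalues G"
  have mset: "mset ?xs = laplacian_spectrum G" by (simp add: laplacian_eigenvalues_def)
  have "sorted_wrt (\<ge>) ?xs" by (simp add: laplacian_eigenvalues_def sorted_wrt_rev)
  then have "take (length (filter (\<lambda>x. c \<le> x) ?xs)) ?xs = filter (\<lambda>x. c \<le> x) ?xs" by (rule take_filter_ge)
  moreover have "length (filter (\<lambda>x. c \<le> x) ?xs) = num_eigenvalues_ge c G"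
    unfolding num_eigenvalues_ge_def mset[symmetric] by (metis mset_filter size_mset)
  ultimately show ?thesis unfolding sum_largest_def mset[symmetric]
    by (metis mset_filter sum_mset_sum_list)
qed

text \<open>No arc joins the two components, so listing the vertices of \<open>H1\<close> before
  those of \<open>H2\<close> makes the Laplacian block diagonal, and its characteristic polynomial
  factors.\<close>

lemma (in graph) laplacian_spectrum_two_components:
  assumes sccs: "sccs = {H1, H2}" and ne: "H1 \<noteq> H2"
  shows "laplacian_spectrum G = laplacian_spectrum H1 + laplacian_spectrum H2"
proof -
  have ind: "induced_subgraph H1 G" "induced_subgraph H2 G" using sccs in_sccs_imp_induced by auto
  have sv: "verts H1 \<in> sccs_verts" "verts H2 \<in> sccs_verts" using sccs by (auto simp: sccs_verts_conv)
  have vne: "verts H1 \<noteq> verts H2"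
    using induce_eq_iff_induced[OF ind(1)] induce_eq_iff_induced[OF ind(2)] ne by auto
  have disj: "verts H1 \<inter> verts H2 = {}" by (rule sccs_verts_disjoint[OF sv vne])
  have sub: "verts H1 \<subseteq> verts G" "verts H2 \<subseteq> verts G" using ind by auto
  have cover: "verts G = verts H1 \<union> verts H2"
  proof
    show "verts G \<subseteq> verts H1 \<union> verts H2"
    proof
      fix u assume u: "u \<in> verts G"
      then have "G \<restriction> {v. u \<rightarrow>\<^sup>* v} \<in> {H1, H2}" using induce_reachable_is_in_sccs sccs by simp
      moreover have "u \<in> verts (G \<restriction> {v. u \<rightarrow>\<^sup>* v})" using u by simp
      ultimately show "u \<in> verts H1 \<union> verts H2" by auto
    qed
  qed (use sub in auto)
  \<comment> \<open>Each arc has an opposite, so the ends of an arc leaving \<open>S\<close> would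
    be mutually reachable and lie in one component.\<close>
  have no_arc: "v \<in> S" if "S \<in> sccs_verts" "u \<in> S" "u \<rightarrow> v" for S u v
  proof (rule ccontr)
    assume "v \<notin> S"
    then have "\<not> u \<rightarrow>\<^sup>* v \<or> \<not> v \<rightarrow>\<^sup>* u" using that(1,2) by (auto simp: sccs_verts_def)
    then show False using that(3) graph_symmetric by blast
  qed
  have adj: "u \<rightarrow>\<^bsub>H\<^esub> v \<longleftrightarrow> u \<rightarrow> v" if "induced_subgraph H G" "u \<in> verts H" "v \<in> verts H" for H u v
    using that by (auto simp: induced_subgraph_def subgraph_def compatible_def arcs_ends_conv)
  \<comment> \<open>All arcs at a vertex stay in its component. Degrees are therefore preserved, and
    the diagonal blocks are the Laplacians of the components themselves.\<close>
  have deg: "out_degree H u = out_degree G u" if "induced_subgraph H G" "verts H \<in> sccs_verts" "u \<in> verts H" for H u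
  proof -
    have "head G a \<in> verts H" if "a \<in> arcs G" "tail G a = u" for a
      using no_arc[OF \<open>verts H \<in> sccs_verts\<close> \<open>u \<in> verts H\<close>] that by (auto simp: arcs_ends_conv)
    then have "out_arcs H u = out_arcs G u" using that
      by (auto simp: induced_subgraph_def subgraph_def compatible_def out_arcs_def)
    then show ?thesis by (simp add: out_degree_def)
  qed
  have fin: "finite (verts H1)" "finite (verts H2)" using sub finite_subset finite_verts by blast+
  let ?vs = "vert_list H1" and ?ws = "vert_list H2"
  note vs = vert_list[OF fin(1)] and ws = vert_list[OF fin(2)]
  have in1: "?vs ! i \<in> verts H1" if "i < length ?vs" for i using that vs(2) nth_mem by metis
  have in2: "?ws ! i \<in> verts H2" if "i < length ?ws" for i using that ws(2) nth_mem by metis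
  have no12: "\<not> u \<rightarrow> v" "\<not> v \<rightarrow> u" if "u \<in> verts H1" "v \<in> verts H2" for u v
    using no_arc[OF sv(1) that(1), of v] no_arc[OF sv(2) that(2), of u] that disj by auto
  have block: "list_laplacian G (?vs @ ?ws) = four_block_mat (list_laplacian H1 ?vs)
      (0\<^sub>m (length ?vs) (length ?ws)) (0\<^sub>m (length ?ws) (length ?vs)) (list_laplacian H2 ?ws)"
    by (rule eq_matI)
      (auto simp: list_laplacian_def nth_append in1 in2 adj[OF ind(1)] adj[OF ind(2)]
        deg[OF ind(1) sv(1)] deg[OF ind(2) sv(2)] no12)
  have "char_poly (laplacian_matrix G) = char_poly (list_laplacian G (?vs @ ?ws))"
    unfolding laplacian_matrix_eq_list_laplacian[OF finite_verts]
    by (rule char_poly_list_laplacian_cong) (use vert_list[OF finite_verts] vs ws disj cover in auto)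
  also have "\<dots> = char_poly (laplacian_matrix H1) * char_poly (laplacian_matrix H2)"
    unfolding block laplacian_matrix_eq_list_laplacian[OF fin(1)] laplacian_matrix_eq_list_laplacian[OF fin(2)]
    by (rule char_poly_block_diag) (auto simp: list_laplacian_def)
  finally have eq: "char_poly (laplacian_matrix G) = char_poly (laplacian_matrix H1) * char_poly (laplacian_matrix H2)" .
  \<comment> \<open>Both factors are monic, hence nonzero, so the root multisets of the factors add
    up.\<close>
  have "char_poly (laplacian_matrix H) \<noteq> 0" for H :: "('a, 'b) pre_digraph"
    using degree_monic_char_poly[OF laplacian_matrix_carrier[of H]] by auto
  then show ?thesis unfolding laplacian_spectrum_def eq by (simp add: proots_mult)
qed

section \<open>Trees and edge deletion\<close>

text \<open>
  A connected vertex set \<open>S\<close> spanning \<open>card S - 1\<close> edges can be enlarged by any adjacent vertex \<open>v\<close>: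
  two edges from \<open>v\<close> into \<open>S\<close>, joined by a path in \<open>S\<close>, would form a cycle.
\<close>

lemma (in graph) card_edges_of_acyclic_connected:
  assumes conn: "Digraph_Component.connected G" and acyc: "\<not> (\<exists>p. cycle p \<and> 3 \<le> length p)"
  shows "card (edges G) + 1 = card (verts G)"
proof -
  define E where "E S = {s \<in> edges G. s \<subseteq> S}" for S
  \<comment> \<open>The paths have to stay inside \<open>S\<close>, so that a detour through a
    vertex outside \<open>S\<close> meets them only at its ends.\<close>
  define good where "good S \<longleftrightarrow> S \<subseteq> verts G \<and> card (E S) + 1 = card S
    \<and> (\<forall>u\<in>S. \<forall>v\<in>S. \<exists>p. apath u p v \<and> set (awalk_verts u p) \<subseteq> S)" for S
  have finE: "finite (E S)" for S unfolding E_def edges_def by simp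
  have sc: "strongly_connected G" using symmetric_connected_imp_strongly_connected[OF sym_arcs conn] .
  have grow: "\<exists>v. v \<notin> S \<and> good (insert v S)" if S: "good S" "S \<noteq> {}" "S \<noteq> verts G" for S
  proof -
    have SV: "S \<subseteq> verts G" and cardS: "card (E S) + 1 = card S" using S(1) by (auto simp: good_def)
    have finS: "finite S" using SV finite_subset finite_verts by blast
    have path: "\<exists>p. apath u p v \<and> set (awalk_verts u p) \<subseteq> S" if "u \<in> S" "v \<in> S" for u v
      using S(1) that by (auto simp: good_def)
    obtain u v where u: "u \<in> S" and v: "v \<notin> S" and uv: "u \<rightarrow> v"
    proof (rule ccontr)
      assume "\<not> thesis"
      then have closed: "\<And>u v. u \<in> S \<Longrightarrow> u \<rightarrow> v \<Longrightarrow> v \<in> S" using that by blast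
      obtain x where x: "x \<in> S" using S(2) by auto
      have "y \<in> S" if "x \<rightarrow>\<^sup>* y" for y
        using that by (induction rule: reachable_induct) (auto intro: x closed)
      then show False using sc x S(3) SV by (auto simp: strongly_connected_def)
    qed
    have vV: "v \<in> verts G" using adj_in_verts uv by auto
    obtain a where a: "a \<in> arcs G" "tail G a = u" "head G a = v" using uv by auto
    obtain a' where a': "a' \<in> arcs G" "tail G a' = v" "head G a' = u"
      using graph_symmetric[OF uv] by auto
    \<comment> \<open>A second neighbour \<open>w\<close> in \<open>S\<close> closes a cycle: from
      \<open>u\<close> to \<open>w\<close> inside \<open>S\<close>, then through \<open>v\<close>
      back to \<open>u\<close>. As \<open>u\<close> and \<open>w\<close> differ, the path has an
      arc, and the cycle has length at least 3.\<close>
    have unique: "w = u" if w: "w \<in> S" "w \<rightarrow> v" for w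
    proof (rule ccontr)
      assume "w \<noteq> u"
      obtain p where p: "apath u p w" "set (awalk_verts u p) \<subseteq> S" using path[OF u w(1)] by auto
      obtain b where b: "b \<in> arcs G" "tail G b = w" "head G b = v" using w by auto
      have pw: "awalk u p w" and dist: "distinct (awalk_verts u p)" using p by (auto simp: apath_def)
      have pne: "p \<noteq> []" using pw \<open>w \<noteq> u\<close> by (auto simp: awalk_Nil_iff)
      have walk: "awalk u (p @ [b, a']) u"
        using pw b a' u v SV vV by (auto simp: awalk_simps)
      have verts: "awalk_verts u (p @ [b, a']) = awalk_verts u p @ [v, u]"
        using awalk_verts_append[OF walk] b a' by simp
      obtain ys where ys: "awalk_verts u p = u # ys"
        using awhd_of_awalk[OF pw] by (metis awalk_verts_non_Nil list.collapse)
      \<comment> \<open>\<open>tl\<close> drops the first of the two occurrences of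
        \<open>u\<close>.\<close>
      have "distinct (tl (awalk_verts u (p @ [b, a'])))"
        using dist p(2) v unfolding verts ys by auto
      then have "cycle (p @ [b, a'])" using walk unfolding cycle_def by blast
      moreover have "3 \<le> length (p @ [b, a'])" using pne by (cases p) auto
      ultimately show False using acyc by blast
    qed
    \<comment> \<open>By uniqueness exactly one edge comes with the new vertex, so the count is
      preserved.\<close>
    have "E (insert v S) = insert {u, v} (E S)"
    proof
      show "E (insert v S) \<subseteq> insert {u, v} (E S)"
      proof
        fix s assume s: "s \<in> E (insert v S)"
        then obtain c where c: "c \<in> arcs G" "s = {tail G c, head G c}" by (auto simp: E_def edges_def)
        have adj: "tail G c \<rightarrow> head G c" using c(1) by (auto simp: arcs_ends_conv)
        have "tail G c \<noteq> head G c" using c no_loops by auto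
        then show "s \<in> insert {u, v} (E S)"
          using s c adj unique graph_symmetric[OF adj] by (auto simp: E_def)
      qed
      show "insert {u, v} (E S) \<subseteq> E (insert v S)"
        using a u by (auto simp: E_def edges_def)
    qed
    moreover have "{u, v} \<notin> E S" using v by (auto simp: E_def)
    ultimately have "card (E (insert v S)) + 1 = card (insert v S)"
      using cardS finE finS v by simp
    \<comment> \<open>A path inside \<open>S\<close> is extended by the arc \<open>a\<close> into
      \<open>v\<close>, or by the arc \<open>a'\<close> out of \<open>v\<close>.\<close>
    moreover have "\<exists>p. apath x p y \<and> set (awalk_verts x p) \<subseteq> insert v S"
      if xy: "x \<in> insert v S" "y \<in> insert v S" for x y
    proof -
      consider "x = v" "y = v" | "x = v" "y \<in> S" | "x \<in> S" "y = v" | "x \<in> S" "y \<in> S" using xy by auto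
      then show ?thesis
      proof cases
        case 1
        then show ?thesis using vV by (intro exI[of _ "[]"]) (auto simp: apath_Nil_iff)
      next
        case 2
        obtain p where p: "apath u p y" "set (awalk_verts u p) \<subseteq> S" using path[OF u 2(2)] by auto
        then show ?thesis using 2 a' v by (intro exI[of _ "a' # p"]) (auto simp: apath_Cons_iff)
      next
        case 3
        obtain p where p: "apath x p u" "set (awalk_verts x p) \<subseteq> S" using path[OF 3(1) u] by auto
        have last: "awlast x p = u" using p by (auto simp: apath_def)
        have "apath x (p @ [a]) v"
          unfolding apath_append_iff last using p a v vV SV u by (auto simp: apath_Cons_iff apath_Nil_iff)
        moreover have "set (awalk_verts x (p @ [a])) \<subseteq> insert v S"
          using awalk_verts_append[of x p "[a]" v] calculation p a last u by (auto simp: apath_def)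
        ultimately show ?thesis using 3 by auto
      next
        case 4
        then show ?thesis using path by blast
      qed
    qed
    ultimately have "good (insert v S)" using SV vV by (auto simp: good_def)
    then show ?thesis using v by blast
  qed
  \<comment> \<open>Growth starts with a single vertex, which spans no edge, and reaches every size
    up to the whole vertex set.\<close>
  have "\<exists>S. good S \<and> card S = Suc k" if "Suc k \<le> card (verts G)" for k
    using that
  proof (induction k)
    case 0
    obtain r where r: "r \<in> verts G" using sc by (auto simp: strongly_connected_def)
    have "E {r} = {}" using no_loops by (auto simp: E_def edges_def)
    then have "good {r}" using r unfolding good_def
      by (auto intro!: exI[of _ "[]"] simp: apath_Nil_iff)
    then show ?case by (intro exI[of _ "{r}"]) simp
  next
    case (Suc k)
    then obtain S where S: "good S" "card S = Suc k" by auto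
    moreover have "S \<noteq> {}" "S \<noteq> verts G" using S(2) Suc.prems by auto
    ultimately obtain v where "v \<notin> S" "good (insert v S)" using grow by blast
    moreover have "finite S" using S(2) by (metis card.infinite nat.distinct(1))
    ultimately show ?case using S by (intro exI[of _ "insert v S"]) simp
  qed
  moreover have "card (verts G) \<noteq> 0" using sc by (auto simp: strongly_connected_def)
  ultimately obtain S where S: "good S" "card S = card (verts G)"
    by (metis not0_implies_Suc order_refl)
  then have "S = verts G" by (intro card_subset_eq) (auto simp: good_def)
  moreover have "E (verts G) = edges G" by (auto simp: E_def edges_def)
  ultimately show ?thesis using S by (simp add: good_def)
qed

section \<open>Deleting an edge\<close>

lemma edges_del_edge: "edges (del_edge G e) = edges G - {e}"
  by (auto simp: edges_def del_edge_def)

lemma verts_del_edge: "verts (del_edge G e) = verts G"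
  by (simp add: del_edge_def)

lemma (in graph) subgraph_del_edge: "subgraph (del_edge G e) G"
proof (rule subgraphI)
  show "wf_digraph (del_edge G e)" by unfold_locales (auto simp: del_edge_def)
  show "wf_digraph G" by unfold_locales
qed (auto simp: del_edge_def compatible_def)

lemma (in graph) graph_del_edge: "graph (del_edge G e)"
proof -
  interpret D: digraph "del_edge G e" by (rule digraph_subgraph[OF subgraph_del_edge])
  \<comment> \<open>Opposite arcs have the same set of ends, so they are deleted or kept
    together.\<close>
  have "symmetric (del_edge G e)"
    using sym_arcs unfolding symmetric_conv
    by (fastforce simp: del_edge_def insert_commute)
  then show ?thesis by (rule D.graphI)
qed

theorem theorem3p6:
  fixes T T1 T2 :: "('a, 'b) pre_digraph" and e :: "'a set" and n \<sigma> k1 k2 :: nat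
  assumes "undirected_tree T"
    and "n = card (verts T)" and "n \<ge> 8"
    and "e \<in> edges T" and "non_pendent T e"
    and "pre_digraph.sccs (del_edge T e) = {T1, T2}" and "T1 \<noteq> T2"
    and "\<sigma> = num_eigenvalues_ge (avg_degree (del_edge T e)) (del_edge T e)"
    and "k1 = num_eigenvalues_ge (avg_degree (del_edge T e)) T1"
    and "k2 = num_eigenvalues_ge (avg_degree (del_edge T e)) T2"
  shows "avg_degree (del_edge T e) = 2 - 4 / real n
    \<and> k1 + k2 = \<sigma>
    \<and> laplacian_energy T
           \<ge> 2 * sum_largest k1 T1 + 2 * sum_largest k2 T2 - 4 * real \<sigma> + 4 * real \<sigma> / real n"
proof -
  interpret T: graph T using assms(1) by (simp add: undirected_tree_def)
  let ?D = "del_edge T e" and ?c = "avg_degree (del_edge T e)"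
  interpret D: graph ?D by (rule T.graph_del_edge)
  have card_T: "card (edges T) + 1 = n"
    using T.card_edges_of_acyclic_connected assms(1,2) by (simp add: undirected_tree_def)
  have "finite (edges T)" by (simp add: edges_def)
  then have card_D: "card (edges ?D) + 2 = n"
    using card_T assms(3,4) by (simp add: edges_del_edge)
  have d_T: "avg_degree T = 2 - 2 / real n"
    using assms(3) by (simp add: avg_degree_def field_simps flip: assms(2) card_T)
  have d_D: "?c = 2 - 4 / real n"
    using assms(3) by (simp add: avg_degree_def verts_del_edge field_simps flip: assms(2) card_D)
  have spec: "laplacian_spectrum ?D = laplacian_spectrum T1 + laplacian_spectrum T2"
    by (rule D.laplacian_spectrum_two_components[OF assms(6,7)])
  have \<sigma>: "k1 + k2 = \<sigma>"
    unfolding assms(8-10) num_eigenvalues_ge_def spec by simp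
  let ?M = "{#\<mu> \<in># laplacian_spectrum ?D. ?c \<le> \<mu>#}"
  have size: "size ?M = \<sigma>" unfolding assms(8) num_eigenvalues_ge_def ..
  \<comment> \<open>Twice the average degree of \<open>T\<close> is 4 - 4/n; subtracting it once per
    selected eigenvalue gives the last two terms.\<close>
  have "2 * sum_largest k1 T1 + 2 * sum_largest k2 T2 - 4 * real \<sigma> + 4 * real \<sigma> / real n
      = 2 * (\<Sum>\<^sub># ?M - real \<sigma> * avg_degree T)"
    unfolding assms(9,10) sum_largest_num_eigenvalues_ge spec d_T by (simp add: algebra_simps)
  also have "\<dots> = 2 * (\<Sum>\<mu>\<in>#?M. \<mu> - avg_degree T)"
    by (simp add: sum_mset_subtractf size)
  \<comment> \<open>The selection uses the average degree of \<open>T - e\<close>, which is smaller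
    than the subtracted average degree of \<open>T\<close>. Some summands may thus be negative, but
    the bound holds for every selection.\<close>
  also have "\<dots> \<le> laplacian_energy T"
    by (rule sum_selected_laplacian_le[OF T.graph_axioms D.graph_axioms verts_del_edge
          arcs_ends_mono[OF T.subgraph_del_edge]])
  finally show ?thesis using d_D \<sigma> by simp
qed

end
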